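(* Let $(\overline{x},\overline{\lambda})\in\mathbb{R}^n\times\mathbb{R}^m$. (i) Assume that $(\overline{x},\overline{\lambda})$ is a critical point of $L$, i.e. $\nabla L(\overline{x},\overline{\lambda})=0$. Then $\overline{x}\in X_e$, $\overline{\lambda}\in Y_{\mathrm{col}}$, and $q_0(\overline{x})=L(\overline{x},\overline{\lambda})=D(\overline{\lambda})$. Moreover, if $\overline{\lambda}\in Y_{\mathrm{col}}^{+}$ then $$q_0(\overline{x})=\inf_{x\in X_e}q_0(x)=L(\overline{x},\overline{\lambda})=\sup_{\lambda\in Y_{\mathrm{col}}^{+}}D(\lambda)=D(\overline{\lambda}),$$ while if $\overline{\lambda}\in Y_{\mathrm{col}}^{-}$ then $$q_0(\overline{x})=\sup_{x\in X_e}q_0(x)=L(\overline{x},\overline{\lambda})=\inf_{\lambda\in Y_{\mathrm{col}}^{-}}D(\lambda)=D(\overline{\lambda}).$$ (ii) Assume that $(\overline{x},\overline{\lambda})$ is a critical point of $L$ with $\overline{\lambda}\in Y_0$. Then $\nabla D(\overline{\lambda})=0$ and $\overline{x}=A(\overline{\lambda})^{-1}b(\overline{\lambda})$; moreover, $\overline{x}$ is the unique global minimizer of $q_0$ on $X_e$ when $\overline{\lambda}\in Y^{+}$, and $\overline{x}$ is the unique global maximizer of $q_0$ on $X_e$ when $\overline{\lambda}\in Y^{-}$. Conversely, assume that $\overline{\lambda}\in Y_0$ is a critical point of $D$ (i.e. $\nabla D(\overline{\lambda})=0$). Then $(\overline{x},\overline{\lambda})$, where $\overline{x}=A(\overline{\lambda})^{-1}b(\overline{\lambda})$,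 is a critical point of $L$; consequently the conclusions of (i) and (ii) hold for it.
   Context: For $k\in\{0,1,\dots,m\}$ let $q_k:\mathbb{R}^n\to\mathbb{R}$, $q_k(x):=\tfrac12\langle x,A_kx\rangle-\langle b_k,x\rangle+c_k$, where $A_k$ is a given real symmetric $n\times n$ matrix, $b_k\in\mathbb{R}^n$, $c_k\in\mathbb{R}$. The feasible set for equality constraints is $X_e:=\{x\in\mathbb{R}^n\mid q_j(x)=0\ \forall j\in\{1,\dots,m\}\}$. For $\lambda\in\mathbb{R}^m$, with $\lambda_0:=1$, put $A(\lambda):=\sum_{k=0}^m\lambda_kA_k$, $b(\lambda):=\sum_{k=0}^m\lambda_kb_k$, $c(\lambda):=\sum_{k=0}^m\lambda_kc_k$. The Lagrangian is $L:\mathbb{R}^n\times\mathbb{R}^m\to\mathbb{R}$, $L(x,\lambda):=q_0(x)+\sum_{j=1}^m\lambda_jq_j(x)=\tfrac12\langle x,A(\lambda)x\rangle-\langle x,b(\lambda)\rangle+c(\lambda)$. Sets ($\succ0$, $\succeq0$, $\prec 0$, $\preceq 0$ mean positive definite, positive semidefinite, negative definite, negative semidefinite): $Y_0:=\{\lambda\in\mathbb{R}^m\mid\det A(\lambda)\ne0\}$, $Y^{+}:=\{\lambda\mid A(\lambda)\succ0\}$, $Y^{-}:=\{\lambda\mid A(\lambda)\prec0\}$, $Y_{\mathrm{col}}:=\{\lambda\mid b(\lambda)\in\operatorname{Im}A(\lambda)\}$, $Y_{\mathrm{col}}^{+}:=\{\lambda\in Y_{\mathrm{col}}\mid A(\lambda)\succeq0\}$,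 $Y_{\mathrm{col}}^{-}:=\{\lambda\in Y_{\mathrm{col}}\mid A(\lambda)\preceq0\}$. The dual function is $D:Y_{\mathrm{col}}\to\mathbb{R}$, $D(\lambda):=L(x,\lambda)$ for any $x$ with $A(\lambda)x=b(\lambda)$ (the value does not depend on the choice of such $x$). On the open set $Y_0\subset Y_{\mathrm{col}}$ one has $D(\lambda)=-\tfrac12\langle b(\lambda),A(\lambda)^{-1}b(\lambda)\rangle+c(\lambda)$, which is smooth. *)

theory Defs
  imports "HOL-Analysis.Analysis"
begin

text \<open>
  The \<open>m + 1\<close> quadratic functions are indexed by \<^typ>\<open>'m option\<close>: the index \<^const>\<open>None\<close> is the
  objective (\<open>k = 0\<close>) and the indices \<^term>\<open>Some j\<close> are the constraints (\<open>k = 1, \<dots>, m\<close>).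
\<close>

definition quad ::
  "('m option \<Rightarrow> real^'n^'n) \<Rightarrow> ('m option \<Rightarrow> real^'n) \<Rightarrow> ('m option \<Rightarrow> real) \<Rightarrow>
    'm option \<Rightarrow> real^'n \<Rightarrow> real" where
  "quad A b c k x = 1/2 * (x \<bullet> (A k *v x)) - b k \<bullet> x + c k"

definition feasible_eq ::
  "('m option \<Rightarrow> real^'n^'n) \<Rightarrow> ('m option \<Rightarrow> real^'n) \<Rightarrow> ('m option \<Rightarrow> real) \<Rightarrow> (real^'n) set" where
  "feasible_eq A b c = {x. \<forall>j. quad A b c (Some j) x = 0}"

definition mult_ext :: "real^'m \<Rightarrow> 'm option \<Rightarrow> real" where
  "mult_ext l k = (case k of None \<Rightarrow> 1 | Some j \<Rightarrow> l $ j)"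

definition lin_comb :: "('m::finite option \<Rightarrow> 'v::real_vector) \<Rightarrow> real^'m \<Rightarrow> 'v" where
  "lin_comb V l = (\<Sum>k\<in>UNIV. mult_ext l k *\<^sub>R V k)"

definition lagrangian ::
  "('m::finite option \<Rightarrow> real^'n^'n) \<Rightarrow> ('m option \<Rightarrow> real^'n) \<Rightarrow> ('m option \<Rightarrow> real) \<Rightarrow>
    real^'n \<Rightarrow> real^'m \<Rightarrow> real" where
  "lagrangian A b c x l = quad A b c None x + (\<Sum>j\<in>UNIV. l $ j * quad A b c (Some j) x)"

text \<open>
  Definiteness refers to the quadratic form only; symmetry of the matrices is assumed separately.
\<close>

definition pos_definite :: "real^'n^'n \<Rightarrow> bool" where
  "pos_definite M \<longleftrightarrow> (\<forall>x. x \<noteq> 0 \<longrightarrow> 0 < x \<bullet> (M *v x))"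

definition pos_semidefinite :: "real^'n^'n \<Rightarrow> bool" where
  "pos_semidefinite M \<longleftrightarrow> (\<forall>x. 0 \<le> x \<bullet> (M *v x))"

definition neg_definite :: "real^'n^'n \<Rightarrow> bool" where
  "neg_definite M \<longleftrightarrow> (\<forall>x. x \<noteq> 0 \<longrightarrow> x \<bullet> (M *v x) < 0)"

definition neg_semidefinite :: "real^'n^'n \<Rightarrow> bool" where
  "neg_semidefinite M \<longleftrightarrow> (\<forall>x. x \<bullet> (M *v x) \<le> 0)"

definition Y_0 :: "('m::finite option \<Rightarrow> real^'n^'n) \<Rightarrow> (real^'m) set" where
  "Y_0 A = {l. det (lin_comb A l) \<noteq> 0}"

definition Y_pos :: "('m::finite option \<Rightarrow> real^'n^'n) \<Rightarrow> (real^'m) set" where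
  "Y_pos A = {l. pos_definite (lin_comb A l)}"

definition Y_neg :: "('m::finite option \<Rightarrow> real^'n^'n) \<Rightarrow> (real^'m) set" where
  "Y_neg A = {l. neg_definite (lin_comb A l)}"

definition Y_col ::
  "('m::finite option \<Rightarrow> real^'n^'n) \<Rightarrow> ('m option \<Rightarrow> real^'n) \<Rightarrow> (real^'m) set" where
  "Y_col A b = {l. lin_comb b l \<in> range (\<lambda>x. lin_comb A l *v x)}"

definition Y_col_pos ::
  "('m::finite option \<Rightarrow> real^'n^'n) \<Rightarrow> ('m option \<Rightarrow> real^'n) \<Rightarrow> (real^'m) set" where
  "Y_col_pos A b = {l \<in> Y_col A b. pos_semidefinite (lin_comb A l)}"

definition Y_col_neg ::
  "('m::finite option \<Rightarrow> real^'n^'n) \<Rightarrow> ('m option \<Rightarrow> real^'n) \<Rightarrow> (real^'m) set" where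
  "Y_col_neg A b = {l \<in> Y_col A b. neg_semidefinite (lin_comb A l)}"

text \<open>
  Only the values on \<^term>\<open>Y_col A b\<close> are meaningful; there the choice of the solution \<open>x\<close> is
  immaterial, see \<open>dual_fun_eq\<close> below.
\<close>

definition dual_fun ::
  "('m::finite option \<Rightarrow> real^'n^'n) \<Rightarrow> ('m option \<Rightarrow> real^'n) \<Rightarrow> ('m option \<Rightarrow> real) \<Rightarrow>
    real^'m \<Rightarrow> real" where
  "dual_fun A b c l = lagrangian A b c (SOME x. lin_comb A l *v x = lin_comb b l) l"

definition critical_point :: "('a::real_inner \<Rightarrow> real) \<Rightarrow> 'a \<Rightarrow> bool" where
  "critical_point f x \<longleftrightarrow> GDERIV f x :> 0"

definition unique_minimizer_on :: "('a \<Rightarrow> real) \<Rightarrow> 'a set \<Rightarrow> 'a \<Rightarrow> bool" where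
  "unique_minimizer_on f S x \<longleftrightarrow>
    is_arg_min f (\<lambda>y. y \<in> S) x \<and> (\<forall>y. is_arg_min f (\<lambda>z. z \<in> S) y \<longrightarrow> y = x)"

definition unique_maximizer_on :: "('a \<Rightarrow> real) \<Rightarrow> 'a set \<Rightarrow> 'a \<Rightarrow> bool" where
  "unique_maximizer_on f S x \<longleftrightarrow>
    is_arg_max f (\<lambda>y. y \<in> S) x \<and> (\<forall>y. is_arg_max f (\<lambda>z. z \<in> S) y \<longrightarrow> y = x)"

lemma lin_comb_eq: "lin_comb V l = V None + (\<Sum>j\<in>UNIV. l $ j *\<^sub>R V (Some j))"
  by (simp add: lin_comb_def mult_ext_def UNIV_option_conv sum.reindex)

lemma lagrangian_eq:
  "lagrangian A b c x l =
    1/2 * (x \<bullet> (lin_comb A l *v x)) - x \<bullet> lin_comb b l + lin_comb c l"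
proof -
  have sum_mv: "(\<Sum>j\<in>S. f j) *v x = (\<Sum>j\<in>S. f j *v x)" for f :: "'a \<Rightarrow> real^'b^'b" and S
    by (induction S rule: infinite_finite_induct) (simp_all add: matrix_vector_mult_add_rdistrib)
  have A: "x \<bullet> (lin_comb A l *v x) =
      x \<bullet> (A None *v x) + (\<Sum>j\<in>UNIV. l $ j * (x \<bullet> (A (Some j) *v x)))"
    unfolding lin_comb_eq matrix_vector_mult_add_rdistrib sum_mv inner_add_right inner_sum_right
      scaleR_matrix_vector_assoc[symmetric] inner_scaleR_right ..
  have b: "x \<bullet> lin_comb b l = b None \<bullet> x + (\<Sum>j\<in>UNIV. l $ j * (b (Some j) \<bullet> x))"
    unfolding lin_comb_eq inner_add_right inner_sum_right inner_scaleR_right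
    by (simp only: inner_commute)
  have c: "lin_comb c l = c None + (\<Sum>j\<in>UNIV. l $ j * c (Some j))"
    unfolding lin_comb_eq by simp
  have "(\<Sum>j\<in>UNIV. l $ j * quad A b c (Some j) x) =
      1/2 * (\<Sum>j\<in>UNIV. l $ j * (x \<bullet> (A (Some j) *v x)))
      - (\<Sum>j\<in>UNIV. l $ j * (b (Some j) \<bullet> x)) + (\<Sum>j\<in>UNIV. l $ j * c (Some j))"
    unfolding quad_def sum_distrib_left sum.distrib[symmetric] sum_subtractf[symmetric]
    by (rule sum.cong) (simp_all only: distrib_left right_diff_distrib mult.left_commute)
  then show ?thesis
    unfolding lagrangian_def A b c by (simp add: quad_def)
qed

lemma transpose_lin_comb:
  assumes "\<And>k. transpose (A k) = A k"
  shows "transpose (lin_comb A l) = lin_comb A l"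
  using assms by (simp add: lin_comb_def transpose_def vec_eq_iff)

lemma dual_fun_eq:
  assumes sym: "\<And>k. transpose (A k) = A k" and x: "lin_comb A l *v x = lin_comb b l"
  shows "dual_fun A b c l = lagrangian A b c x l"
proof -
  define y where "y = (SOME x. lin_comb A l *v x = lin_comb b l)"
  have y: "lin_comb A l *v y = lin_comb b l"
    unfolding y_def using x by (rule someI)
  have "x \<bullet> lin_comb b l = (x v* lin_comb A l) \<bullet> y"
    unfolding dot_lmul_matrix y ..
  also have "x v* lin_comb A l = lin_comb A l *v x"
    unfolding transpose_matrix_vector[symmetric] transpose_lin_comb[OF sym] ..
  finally have "x \<bullet> lin_comb b l = lin_comb b l \<bullet> y"
    unfolding x .
  then show ?thesis
    unfolding dual_fun_def y_def[symmetric] lagrangian_eq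
    by (simp add: x y inner_commute)
qed

end

theory Submission
  imports Defs
begin

text \<open>
  Symmetry of the matrices gives \<open>L(y, \<lambda>) = L(x, \<lambda>) + 1/2 \<langle>y - x, A(\<lambda>)(y - x)\<rangle>\<close> whenever
  \<open>A(\<lambda>)x = b(\<lambda>)\<close>. Critical points of \<open>L\<close> are the pairs with \<open>A(\<lambda>)x = b(\<lambda>)\<close> and \<open>x\<close> feasible, and
  \<open>L(\<cdot>, \<lambda>)\<close> coincides with \<open>q\<^sub>0\<close> on the feasible set; so weak duality with equality at the critical
  point gives the min-max statements, and strict definiteness the uniqueness.
  For the gradient of \<open>D\<close>, let \<open>x\<close>, \<open>x'\<close> solve \<open>A(\<lambda>)x = b(\<lambda>)\<close> and \<open>A(\<lambda>')x' = b(\<lambda>')\<close>, and let \<open>p\<^sub>k\<close> be the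
  polarisation of \<open>q\<^sub>k\<close> at \<open>(x, x')\<close>. Then \<open>D(\<lambda>') - D(\<lambda>)\<close> equals \<open>\<Sum>\<^sub>j (\<lambda>'\<^sub>j - \<lambda>\<^sub>j) p\<^sub>j\<close> exactly, and \<open>p\<^sub>j\<close>
  tends to \<open>q\<^sub>j(x)\<close> as \<open>\<lambda>' \<rightarrow> \<lambda>\<close> because \<open>x'\<close> depends continuously on \<open>\<lambda>'\<close> by Cramer's rule.
\<close>

section \<open>Gradients obtained from exact factorisations of increments\<close>

lemma GDERIV_Caratheodory:
  fixes f :: "'a::real_inner \<Rightarrow> real"
  assumes eq: "\<forall>\<^sub>F y in at x. f y - f x = (y - x) \<bullet> g y"
    and lim: "(g \<longlongrightarrow> d) (at x)"
  shows "GDERIV f x :> d"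
  unfolding gderiv_def has_derivative_iff_norm
proof
  show "bounded_linear (\<lambda>h. h \<bullet> d)"
    by (rule bounded_linear_inner_left)
  have "((\<lambda>y. norm (g y - d)) \<longlongrightarrow> 0) (at x)"
    using lim by (simp add: tendsto_norm_zero_iff LIM_zero_iff)
  \<comment> \<open>By Cauchy-Schwarz the difference quotient of the remainder is at most the
    distance of the slope \<open>g y\<close> from \<open>d\<close>, so convergence of
    \<open>g\<close> alone suffices.\<close>
  moreover have "\<forall>\<^sub>F y in at x.
      norm (norm (f y - f x - (y - x) \<bullet> d) / norm (y - x)) \<le> norm (norm (g y - d)) * 1"
    using eq
  proof eventually_elim
    case (elim y)
    have "f y - f x - (y - x) \<bullet> d = (y - x) \<bullet> (g y - d)"
      using elim by (simp add: inner_diff_right)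
    then have "norm (f y - f x - (y - x) \<bullet> d) \<le> norm (y - x) * norm (g y - d)"
      using Cauchy_Schwarz_ineq2[of "y - x" "g y - d"] by simp
    then show ?case
      by (cases "y = x") (simp_all add: divide_simps mult.commute)
  qed
  ultimately show "((\<lambda>y. norm (f y - f x - (y - x) \<bullet> d) / norm (y - x)) \<longlongrightarrow> 0) (at x)"
    by (rule tendsto_0_le)
qed

text \<open>Uniqueness of the derivative turns criticality into an equation for whichever gradient
  has been computed.\<close>

lemma critical_point_iff_gradient:
  fixes f :: "'a::real_inner \<Rightarrow> real"
  assumes "GDERIV f x :> d"
  shows "critical_point f x \<longleftrightarrow> d = 0"
proof
  assume "critical_point f x"
  then have "GDERIV f x :> 0"
    by (simp add: critical_point_def)
  with assms have "(\<lambda>h. h \<bullet> d) = (\<lambda>h. h \<bullet> 0)"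
    unfolding gderiv_def by (rule has_derivative_unique)
  then have "d \<bullet> d = 0"
    by (metis inner_zero_right)
  then show "d = 0"
    by simp
qed (use assms in \<open>simp add: critical_point_def\<close>)

section \<open>Continuity of the solution of a linear system\<close>

lemma matrix_vector_mult_eq_iff_matrix_inv:
  fixes M :: "'a::field^'n^'n"
  assumes "det M \<noteq> 0"
  shows "M *v x = v \<longleftrightarrow> x = matrix_inv M *v v"
proof -
  have "\<exists>N. M ** N = mat 1 \<and> N ** M = mat 1"
    using assms invertible_det_nz[of M] by (simp add: invertible_def)
  then have "M ** matrix_inv M = mat 1 \<and> matrix_inv M ** M = mat 1"
    unfolding matrix_inv_def by (rule someI_ex)
  then show ?thesis
    by (metis matrix_vector_mul_assoc matrix_vector_mul_lid)
qed

lemma tendsto_det: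
  fixes M :: "'a \<Rightarrow> real^'n^'n"
  assumes "(M \<longlongrightarrow> M') F"
  shows "((\<lambda>t. det (M t)) \<longlongrightarrow> det M') F"
  unfolding det_def by (intro tendsto_intros tendsto_vec_nth assms)

lemma tendsto_matrix_vector_mult:
  fixes M :: "'a \<Rightarrow> real^'n^'m"
  assumes "(M \<longlongrightarrow> M') F" and "(v \<longlongrightarrow> v') F"
  shows "((\<lambda>t. M t *v v t) \<longlongrightarrow> M' *v v') F"
  unfolding matrix_vector_mult_def by (intro tendsto_intros tendsto_vec_nth assms)

text \<open>Cramer's rule makes each coordinate a quotient of determinants, which are polynomials in
  the entries.\<close>

lemma tendsto_matrix_inv_mult_vector:
  fixes M :: "'a \<Rightarrow> real^'n^'n"
  assumes M: "(M \<longlongrightarrow> M') F" and v: "(v \<longlongrightarrow> v') F" and "det M' \<noteq> 0"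
  shows "((\<lambda>t. matrix_inv (M t) *v v t) \<longlongrightarrow> matrix_inv M' *v v') F"
proof -
  define C :: "real^'n^'n \<Rightarrow> real^'n \<Rightarrow> real^'n" where
    "C = (\<lambda>N w. \<chi> k. det (\<chi> i j. if j = k then w $ i else N $ i $ j) / det N)"
  have C: "matrix_inv N *v w = C N w" if "det N \<noteq> 0" for N w
    using matrix_vector_mult_eq_iff_matrix_inv[OF that, of "C N w" w] cramer[OF that, of "C N w" w]
    by (simp add: C_def)
  have "((\<lambda>t. (\<chi> i j. if j = k then v t $ i else M t $ i $ j)) \<longlongrightarrow>
      (\<chi> i j. if j = k then v' $ i else M' $ i $ j)) F" for k
  proof (intro tendsto_vec_lambda)
    show "((\<lambda>t. if j = k then v t $ i else M t $ i $ j) \<longlongrightarrow>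
        (if j = k then v' $ i else M' $ i $ j)) F" for i j
      by (cases "j = k") (simp_all add: tendsto_vec_nth M v)
  qed
  then have "((\<lambda>t. C (M t) (v t)) \<longlongrightarrow> C M' v') F"
    unfolding C_def
    by (intro tendsto_vec_lambda[of "\<lambda>t k. _ t k / _ t"] tendsto_divide tendsto_det[OF M] \<open>det M' \<noteq> 0\<close>)
      (rule tendsto_det)
  \<comment> \<open>Cramer's formula is justified only for nonzero determinants, which holds
    eventually because the limit determinant is nonzero.\<close>
  moreover have "\<forall>\<^sub>F t in F. C (M t) (v t) = matrix_inv (M t) *v v t"
    using tendsto_imp_eventually_ne[OF tendsto_det[OF M] \<open>det M' \<noteq> 0\<close>]
    by eventually_elim (simp add: C)
  ultimately show ?thesis
    unfolding C[OF \<open>det M' \<noteq> 0\<close>] by (rule Lim_transform_eventually)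
qed

section \<open>Weighted sums of the data and polarisation\<close>

lemma inner_symmetric_matrix:
  fixes M :: "real^'n^'n"
  assumes "transpose M = M"
  shows "x \<bullet> (M *v y) = (M *v x) \<bullet> y"
  by (metis assms dot_lmul_matrix transpose_matrix_vector)

lemma linear_lin_comb:
  assumes "linear f"
  shows "f (lin_comb V l) = lin_comb (\<lambda>k. f (V k)) l"
  by (simp add: lin_comb_def linear_sum[OF assms] linear_scale[OF assms])

text \<open>The index \<open>None\<close> has weight 1 for every multiplier, so it cancels.\<close>

lemma lin_comb_diff_eq_inner:
  fixes V :: "'m::finite option \<Rightarrow> real"
  shows "lin_comb V l' - lin_comb V l = (l' - l) \<bullet> (\<chi> j. V (Some j))"
  by (simp add: lin_comb_eq inner_vec_def left_diff_distrib sum_subtractf)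

lemma tendsto_lin_comb:
  fixes V :: "'m::finite option \<Rightarrow> 'v::real_normed_vector"
  assumes "(l \<longlongrightarrow> l') F"
  shows "((\<lambda>t. lin_comb V (l t)) \<longlongrightarrow> lin_comb V l') F"
  unfolding lin_comb_eq by (intro tendsto_intros tendsto_vec_nth assms)

text \<open>The polarised form depends linearly on the coefficients, hence commutes with weighted
  sums; for \<open>y = x\<close> it is \<open>quad\<close> itself.\<close>

lemma lin_comb_polarised_quad:
  fixes A :: "'m::finite option \<Rightarrow> real^'n^'n"
  shows "lin_comb (\<lambda>k. 1/2 * (x \<bullet> (A k *v y)) - 1/2 * (b k \<bullet> (x + y)) + c k) l =
    1/2 * (x \<bullet> (lin_comb A l *v y)) - 1/2 * (lin_comb b l \<bullet> (x + y)) + lin_comb c l"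
proof -
  have "linear (\<lambda>M::real^'n^'n. x \<bullet> (M *v y))"
    by (rule linearI) (simp_all add: matrix_vector_mult_add_rdistrib inner_add_right
        scaleR_matrix_vector_assoc[symmetric])
  then have A: "x \<bullet> (lin_comb A l *v y) = lin_comb (\<lambda>k. x \<bullet> (A k *v y)) l"
    by (rule linear_lin_comb)
  have "linear (\<lambda>u. u \<bullet> (x + y))"
    by (rule linearI) (simp_all add: inner_add_left)
  then have b: "lin_comb b l \<bullet> (x + y) = lin_comb (\<lambda>k. b k \<bullet> (x + y)) l"
    by (rule linear_lin_comb)
  show ?thesis
    unfolding A b unfolding lin_comb_def
    by (simp add: sum_distrib_left sum.distrib sum_subtractf algebra_simps)
qed

lemma lagrangian_eq_lin_comb:
  "lagrangian A b c x l = lin_comb (\<lambda>k. quad A b c k x) l"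
  by (simp add: lagrangian_def lin_comb_eq)

lemma lagrangian_feasible:
  assumes "x \<in> feasible_eq A b c"
  shows "lagrangian A b c x l = quad A b c None x"
  using assms by (simp add: lagrangian_def feasible_eq_def)

section \<open>Gradients of the Lagrangian and of the dual function\<close>

context
  fixes A :: "'m::finite option \<Rightarrow> real^'n^'n"
    and b :: "'m option \<Rightarrow> real^'n"
    and c :: "'m option \<Rightarrow> real"
  assumes sym: "\<And>k. transpose (A k) = A k"
begin

lemma inner_lin_comb_matrix:
  "x \<bullet> (lin_comb A l *v y) = (lin_comb A l *v x) \<bullet> y"
  by (rule inner_symmetric_matrix[OF transpose_lin_comb[OF sym]])

lemma lagrangian_expansion:
  assumes "lin_comb A l *v x = lin_comb b l"
  shows "lagrangian A b c y l =
    lagrangian A b c x l + 1/2 * ((y - x) \<bullet> (lin_comb A l *v (y - x)))"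
  using assms inner_lin_comb_matrix[of x l y]
  by (simp add: lagrangian_eq matrix_vector_mult_diff_distrib inner_diff_left inner_diff_right
      inner_commute field_simps)

lemma GDERIV_lagrangian:
  "GDERIV (\<lambda>(x, l). lagrangian A b c x l) (x, l) :>
    (lin_comb A l *v x - lin_comb b l, \<chi> j. quad A b c (Some j) x)"
proof (rule GDERIV_Caratheodory)
  \<comment> \<open>The increment is split at \<open>(x, k)\<close>: moving \<open>x\<close> to
    \<open>y\<close> at the new multiplier gives the gradient of a quadratic at the midpoint, and
    moving \<open>l\<close> to \<open>k\<close> at fixed \<open>x\<close> gives a constant slope
    because the Lagrangian is affine in the multiplier.\<close>
  define g where "g = (\<lambda>p::(real^'n) \<times> (real^'m).
    ((1/2) *\<^sub>R (lin_comb A (snd p) *v (fst p + x)) - lin_comb b (snd p),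
      \<chi> j. quad A b c (Some j) x))"
  have "lagrangian A b c y k - lagrangian A b c x l = ((y, k) - (x, l)) \<bullet> g (y, k)" for y k
  proof -
    have "lagrangian A b c y k - lagrangian A b c x k =
        (y - x) \<bullet> ((1/2) *\<^sub>R (lin_comb A k *v (y + x)) - lin_comb b k)"
      using inner_lin_comb_matrix[of x k y]
      by (simp add: lagrangian_eq matrix_vector_right_distrib inner_diff_left inner_diff_right
          inner_add_right inner_commute field_simps)
    moreover have "lagrangian A b c x k - lagrangian A b c x l =
        (k - l) \<bullet> (\<chi> j. quad A b c (Some j) x)"
      by (simp add: lagrangian_eq_lin_comb lin_comb_diff_eq_inner)
    ultimately show ?thesis
      by (simp add: g_def)
  qed
  then show "\<forall>\<^sub>F p in at (x, l). (case p of (x, l) \<Rightarrow> lagrangian A b c x l) -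
      (case (x, l) of (x, l) \<Rightarrow> lagrangian A b c x l) = (p - (x, l)) \<bullet> g p"
    by (auto intro: always_eventually)
  have "(g \<longlongrightarrow> g (x, l)) (at (x, l))"
    unfolding g_def fst_conv snd_conv
    by (intro tendsto_intros tendsto_matrix_vector_mult tendsto_lin_comb
        tendsto_fst[of "\<lambda>p. p" "(x, l)", simplified] tendsto_snd[of "\<lambda>p. p" "(x, l)", simplified])
  also have "g (x, l) = (lin_comb A l *v x - lin_comb b l, \<chi> j. quad A b c (Some j) x)"
    by (simp add: g_def matrix_vector_right_distrib flip: scaleR_2)
  finally show "(g \<longlongrightarrow> \<dots>) (at (x, l))" .
qed

lemma critical_point_lagrangian_iff:
  "critical_point (\<lambda>(x, l). lagrangian A b c x l) (x, l) \<longleftrightarrow>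
    lin_comb A l *v x = lin_comb b l \<and> x \<in> feasible_eq A b c"
  unfolding critical_point_iff_gradient[OF GDERIV_lagrangian]
  by (auto simp: zero_prod_def vec_eq_iff feasible_eq_def)

text \<open>Both dual values are weighted sums of the same family \<open>P\<close>: inserting either
  equation cancels half of the linear term against the quadratic term. So the increment is linear in
  \<open>l' - l\<close>.\<close>

lemma dual_fun_diff:
  assumes x: "lin_comb A l *v x = lin_comb b l" and x': "lin_comb A l' *v x' = lin_comb b l'"
  shows "dual_fun A b c l' - dual_fun A b c l =
    (l' - l) \<bullet> (\<chi> j. 1/2 * (x \<bullet> (A (Some j) *v x')) - 1/2 * (b (Some j) \<bullet> (x + x')) + c (Some j))"
proof -
  define P where "P k = 1/2 * (x \<bullet> (A k *v x')) - 1/2 * (b k \<bullet> (x + x')) + c k" for k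
  have "dual_fun A b c l' = lin_comb P l'"
    unfolding dual_fun_eq[OF sym x'] lagrangian_eq P_def lin_comb_polarised_quad x'
    by (simp add: inner_add_right inner_commute field_simps)
  moreover have "dual_fun A b c l = lin_comb P l"
    unfolding dual_fun_eq[OF sym x] lagrangian_eq P_def lin_comb_polarised_quad
      inner_lin_comb_matrix x
    by (simp add: inner_add_right inner_commute field_simps)
  ultimately show ?thesis
    by (simp add: lin_comb_diff_eq_inner P_def)
qed

lemma GDERIV_dual_fun:
  assumes "l \<in> Y_0 A" and x: "lin_comb A l *v x = lin_comb b l"
  shows "GDERIV (dual_fun A b c) l :> (\<chi> j. quad A b c (Some j) x)"
proof (rule GDERIV_Caratheodory)
  define X where "X k = matrix_inv (lin_comb A k) *v lin_comb b k" for k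
  define g :: "real^'m \<Rightarrow> real^'m" where
    "g k = (\<chi> j. 1/2 * (x \<bullet> (A (Some j) *v X k)) - 1/2 * (b (Some j) \<bullet> (x + X k)) + c (Some j))"
    for k
  have det: "det (lin_comb A l) \<noteq> 0"
    using assms(1) by (simp add: Y_0_def)
  have lim: "((\<lambda>k. k) \<longlongrightarrow> l) (at l)"
    by (rule tendsto_ident_at)
  \<comment> \<open>Near \<open>l\<close> the matrix stays invertible, so there \<open>X k\<close>
    really solves the system.\<close>
  have "\<forall>\<^sub>F k in at l. det (lin_comb A k) \<noteq> 0"
    by (rule tendsto_imp_eventually_ne[OF tendsto_det[OF tendsto_lin_comb[OF lim]] det])
  then show "\<forall>\<^sub>F k in at l. dual_fun A b c k - dual_fun A b c l = (k - l) \<bullet> g k"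
  proof eventually_elim
    case (elim k)
    then have "lin_comb A k *v X k = lin_comb b k"
      by (simp add: matrix_vector_mult_eq_iff_matrix_inv X_def)
    then show ?case
      unfolding g_def by (rule dual_fun_diff[OF x])
  qed
  have "X l = x"
    using x matrix_vector_mult_eq_iff_matrix_inv[OF det] by (simp add: X_def)
  moreover have "(X \<longlongrightarrow> X l) (at l)"
    unfolding X_def by (intro tendsto_matrix_inv_mult_vector tendsto_lin_comb lim det)
  ultimately have "(X \<longlongrightarrow> x) (at l)"
    by simp
  then have "(g \<longlongrightarrow> (\<chi> j. 1/2 * (x \<bullet> (A (Some j) *v x)) - 1/2 * (b (Some j) \<bullet> (x + x)) +
      c (Some j))) (at l)"
    unfolding g_def by (intro tendsto_intros tendsto_matrix_vector_mult)
  also have "(\<chi> j. 1/2 * (x \<bullet> (A (Some j) *v x)) - 1/2 * (b (Some j) \<bullet> (x + x)) + c (Some j)) =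
      (\<chi> j. quad A b c (Some j) x)"
    by (simp add: quad_def vec_eq_iff flip: scaleR_2)
  finally show "(g \<longlongrightarrow> (\<chi> j. quad A b c (Some j) x)) (at l)" .
qed

text \<open>The gradient of the dual consists of the constraint values at \<open>x\<close>. With
  \<open>critical_point_lagrangian_iff\<close> this yields both directions of the correspondence
  between critical points.\<close>

lemma critical_point_dual_fun_iff:
  assumes "l \<in> Y_0 A" and "lin_comb A l *v x = lin_comb b l"
  shows "critical_point (dual_fun A b c) l \<longleftrightarrow> x \<in> feasible_eq A b c"
  unfolding critical_point_iff_gradient[OF GDERIV_dual_fun[OF assms]]
  by (simp add: vec_eq_iff feasible_eq_def)

section \<open>Weak duality and optimality at critical points\<close>

lemma dual_fun_le_quad:
  assumes "l \<in> Y_col_pos A b" and "y \<in> feasible_eq A b c"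
  shows "dual_fun A b c l \<le> quad A b c None y"
proof -
  obtain x where x: "lin_comb A l *v x = lin_comb b l"
    using assms(1) by (force simp: Y_col_pos_def Y_col_def)
  have "0 \<le> (y - x) \<bullet> (lin_comb A l *v (y - x))"
    using assms(1) by (simp add: Y_col_pos_def pos_semidefinite_def)
  then show ?thesis
    using lagrangian_expansion[OF x, of y]
    by (simp add: dual_fun_eq[OF sym x] lagrangian_feasible[OF assms(2)])
qed

lemma quad_le_dual_fun:
  assumes "l \<in> Y_col_neg A b" and "y \<in> feasible_eq A b c"
  shows "quad A b c None y \<le> dual_fun A b c l"
proof -
  obtain x where x: "lin_comb A l *v x = lin_comb b l"
    using assms(1) by (force simp: Y_col_neg_def Y_col_def)
  have "(y - x) \<bullet> (lin_comb A l *v (y - x)) \<le> 0"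
    using assms(1) by (simp add: Y_col_neg_def neg_semidefinite_def)
  then show ?thesis
    using lagrangian_expansion[OF x, of y]
    by (simp add: dual_fun_eq[OF sym x] lagrangian_feasible[OF assms(2)])
qed

lemma critical_value:
  assumes "lin_comb A l *v x = lin_comb b l" and "x \<in> feasible_eq A b c"
  shows "quad A b c None x = lagrangian A b c x l" and "dual_fun A b c l = lagrangian A b c x l"
  using assms by (simp_all add: lagrangian_feasible dual_fun_eq[OF sym])

text \<open>Weak duality gives one inequality for each extremum; \<open>x\<close> and
  \<open>l\<close> themselves attain the common value. In \<open>ereal\<close> no boundedness has to
  be shown first.\<close>

lemma min_max_duality:
  assumes x: "lin_comb A l *v x = lin_comb b l" and feas: "x \<in> feasible_eq A b c"
    and pos: "l \<in> Y_col_pos A b"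
  shows "(INF y\<in>feasible_eq A b c. ereal (quad A b c None y)) = ereal (lagrangian A b c x l)"
    and "(SUP k\<in>Y_col_pos A b. ereal (dual_fun A b c k)) = ereal (lagrangian A b c x l)"
proof -
  note val = critical_value[OF x feas]
  show "(INF y\<in>feasible_eq A b c. ereal (quad A b c None y)) = ereal (lagrangian A b c x l)"
    using dual_fun_le_quad[OF pos] val by (intro antisym INF_lower2[OF feas] INF_greatest) auto
  show "(SUP k\<in>Y_col_pos A b. ereal (dual_fun A b c k)) = ereal (lagrangian A b c x l)"
    using dual_fun_le_quad[OF _ feas] val by (intro antisym SUP_upper2[OF pos] SUP_least) auto
qed

lemma max_min_duality:
  assumes x: "lin_comb A l *v x = lin_comb b l" and feas: "x \<in> feasible_eq A b c"
    and neg: "l \<in> Y_col_neg A b"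
  shows "(SUP y\<in>feasible_eq A b c. ereal (quad A b c None y)) = ereal (lagrangian A b c x l)"
    and "(INF k\<in>Y_col_neg A b. ereal (dual_fun A b c k)) = ereal (lagrangian A b c x l)"
proof -
  note val = critical_value[OF x feas]
  show "(SUP y\<in>feasible_eq A b c. ereal (quad A b c None y)) = ereal (lagrangian A b c x l)"
    using quad_le_dual_fun[OF neg] val by (intro antisym SUP_upper2[OF feas] SUP_least) auto
  show "(INF k\<in>Y_col_neg A b. ereal (dual_fun A b c k)) = ereal (lagrangian A b c x l)"
    using quad_le_dual_fun[OF _ feas] val by (intro antisym INF_lower2[OF neg] INF_greatest) auto
qed

lemma unique_minimizer_critical:
  assumes x: "lin_comb A l *v x = lin_comb b l" and feas: "x \<in> feasible_eq A b c"
    and "l \<in> Y_pos A"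
  shows "unique_minimizer_on (quad A b c None) (feasible_eq A b c) x"
proof -
  have "quad A b c None x < quad A b c None y" if "y \<in> feasible_eq A b c" "y \<noteq> x" for y
  proof -
    have "0 < (y - x) \<bullet> (lin_comb A l *v (y - x))"
      using assms(3) that(2) by (simp add: Y_pos_def pos_definite_def)
    then show ?thesis
      using lagrangian_expansion[OF x, of y]
      by (simp add: lagrangian_feasible[OF feas] lagrangian_feasible[OF that(1)])
  qed
  then show ?thesis
    unfolding unique_minimizer_on_def is_arg_min_def using feas by (metis order_less_asym)
qed

lemma unique_maximizer_critical:
  assumes x: "lin_comb A l *v x = lin_comb b l" and feas: "x \<in> feasible_eq A b c"
    and "l \<in> Y_neg A"
  shows "unique_maximizer_on (quad A b c None) (feasible_eq A b c) x"
proof -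
  have "quad A b c None y < quad A b c None x" if "y \<in> feasible_eq A b c" "y \<noteq> x" for y
  proof -
    have "(y - x) \<bullet> (lin_comb A l *v (y - x)) < 0"
      using assms(3) that(2) by (simp add: Y_neg_def neg_definite_def)
    then show ?thesis
      using lagrangian_expansion[OF x, of y]
      by (simp add: lagrangian_feasible[OF feas] lagrangian_feasible[OF that(1)])
  qed
  then show ?thesis
    unfolding unique_maximizer_on_def is_arg_max_def using feas by (metis order_less_asym)
qed

end

theorem proposition5:
  fixes A :: "'m::finite option \<Rightarrow> real^'n^'n"
    and b :: "'m option \<Rightarrow> real^'n"
    and c :: "'m option \<Rightarrow> real"
    and xbar :: "real^'n"
    and lbar :: "real^'m"
  assumes sym: "\<And>k. transpose (A k) = A k"
  shows
    "let q0 = quad A b c None; Xe = feasible_eq A b c;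
         L = lagrangian A b c; D = dual_fun A b c;
         critical_L = critical_point (\<lambda>(x, l). L x l) (xbar, lbar);
         xbar_eq = (xbar = matrix_inv (lin_comb A lbar) *v lin_comb b lbar);
         conclusion_i =
           (xbar \<in> Xe \<and> lbar \<in> Y_col A b \<and> q0 xbar = L xbar lbar \<and> L xbar lbar = D lbar \<and>
            (lbar \<in> Y_col_pos A b \<longrightarrow>
               ereal (q0 xbar) = (INF x\<in>Xe. ereal (q0 x)) \<and>
               (INF x\<in>Xe. ereal (q0 x)) = ereal (L xbar lbar) \<and>
               ereal (L xbar lbar) = (SUP l\<in>Y_col_pos A b. ereal (D l)) \<and>
               (SUP l\<in>Y_col_pos A b. ereal (D l)) = ereal (D lbar)) \<and>
            (lbar \<in> Y_col_neg A b \<longrightarrow>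
               ereal (q0 xbar) = (SUP x\<in>Xe. ereal (q0 x)) \<and>
               (SUP x\<in>Xe. ereal (q0 x)) = ereal (L xbar lbar) \<and>
               ereal (L xbar lbar) = (INF l\<in>Y_col_neg A b. ereal (D l)) \<and>
               (INF l\<in>Y_col_neg A b. ereal (D l)) = ereal (D lbar)));
         conclusion_ii =
           (critical_point D lbar \<and> xbar_eq \<and>
            (lbar \<in> Y_pos A \<longrightarrow> unique_minimizer_on q0 Xe xbar) \<and>
            (lbar \<in> Y_neg A \<longrightarrow> unique_maximizer_on q0 Xe xbar))
     in (critical_L \<longrightarrow> conclusion_i) \<and>
        (critical_L \<and> lbar \<in> Y_0 A \<longrightarrow> conclusion_ii) \<and>
        (lbar \<in> Y_0 A \<and> critical_point D lbar \<and> xbar_eq \<longrightarrow>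
           critical_L \<and> conclusion_i \<and> conclusion_ii)"
proof -
  let ?solves = "lin_comb A lbar *v xbar = lin_comb b lbar"
  let ?feasible = "xbar \<in> feasible_eq A b c"
  note crit_L = critical_point_lagrangian_iff[where A = A, OF sym]
  have solves_iff: "xbar = matrix_inv (lin_comb A lbar) *v lin_comb b lbar \<longleftrightarrow> ?solves"
    if "lbar \<in> Y_0 A"
    using that by (intro matrix_vector_mult_eq_iff_matrix_inv[symmetric]) (simp add: Y_0_def)
  note crit_D = critical_point_dual_fun_iff[where A = A and b = b and c = c, OF sym]
  show ?thesis
  \<comment> \<open>Each of the three premises forces these two conditions, so the conclusions only
    need proof when both hold.\<close>
  proof (cases "?solves \<and> ?feasible")
    case True
    then have solves: ?solves and feasible: ?feasible
      by simp_all
    have col: "lbar \<in> Y_col A b"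
      using solves unfolding Y_col_def by (metis (mono_tags, lifting) mem_Collect_eq rangeI)
    note val = critical_value[where A = A, OF sym solves feasible]
    note duality = min_max_duality[where A = A, OF sym solves feasible]
      max_min_duality[where A = A, OF sym solves feasible]
    note unique = unique_minimizer_critical[where A = A, OF sym solves feasible]
      unique_maximizer_critical[where A = A, OF sym solves feasible]
    show ?thesis
    proof (cases "lbar \<in> Y_0 A")
      case True
      then have "matrix_inv (lin_comb A lbar) *v lin_comb b lbar = xbar"
        using solves_iff solves by simp
      with True show ?thesis
        by (simp add: Let_def crit_L solves feasible col val duality unique crit_D[OF _ solves])
    \<comment> \<open>Off \<open>Y_0\<close> only the first implication has a premise that can
      hold.\<close>
    next
      case False
      then show ?thesis
        by (simp add: Let_def crit_L solves feasible col val duality)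
    qed
  next
    \<comment> \<open>Now all premises fail: the first two by \<open>crit_L\<close>, the third
      because on \<open>Y_0\<close> the formula for \<open>xbar\<close> gives
      \<open>?solves\<close>, and then \<open>crit_D\<close> gives \<open>?feasible\<close>.\<close>
    case False
    then show ?thesis
      unfolding Let_def crit_L using solves_iff crit_D by blast
  qed
qed

end
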